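(* $\mathbf{BIM}$ does not prove $\mathrm{CF_d}$.
   Context: $\mathbf{BIM}$ (Basic Intuitionistic Mathematics, W. Veldman): two-sorted intuitionistic system with number variables and function variables (one-place number-theoretic functions), number equality primitive, no $\lambda$-abstraction. Constants: $0$, a unary constant for the constant-zero function, one for the identity, successor $S$, a binary pairing function $J$ onto $\mathbb{N}$ and projections $K,L$. With $\alpha(m,n)$ for $\alpha(J(m,n))$, axioms: equality axioms, induction for all formulas, axioms on the constants, closure of functions under composition, pairing and primitive recursion ($\forall\alpha\forall\beta\exists\gamma\forall m\forall n[\gamma(m,0)=\alpha(m)\,\&\,\gamma(m,S(n))=\beta(m,n,\gamma(m,n))]$), and unbounded search $\forall\alpha[\forall m\exists n\,\alpha(m,n)=0\to\exists\gamma\forall m[\alpha(m,\gamma(m))=0\,\&\,\forall n<\gamma(m)\,\alpha(m,n)\neq0]]$. $\mathrm{CF_d}$: $\forall x(B(x)\vee\neg B(x))\to\exists\beta\forall x[\beta(x)\le 1\,\&\,(\beta(x)=0\leftrightarrow B(x))]$ ($\beta$ not free in $B$). *)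

theory Defs
  imports Main
begin

text \<open>
  Variables of both sorts are named by natural numbers. The function terms are exactly the function
  variables and the unary function constants. The pairing symbol is binary, hence not a function term.
\<close>

datatype fterm = FVar nat | ZeroF | IdF | SuccF | KF | LF

datatype nterm = NVar nat | Zero (\<open>\<^bold>0\<close>) | App fterm nterm (infixr \<open>\<^bold>\<cdot>\<close> 80) | NPair nterm nterm (\<open>J\<close>)

datatype fm =
    Eq nterm nterm (infix \<open>\<^bold>=\<close> 70)
  | Falsum (\<open>\<^bold>\<bottom>\<close>)
  | And fm fm (infixr \<open>\<^bold>\<and>\<close> 60)
  | Or fm fm (infixr \<open>\<^bold>\<or>\<close> 55)
  | Imp fm fm (infixr \<open>\<^bold>\<rightarrow>\<close> 51)
  | AllN nat fm
  | ExN nat fm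
  | AllF nat fm
  | ExF nat fm

abbreviation Neg :: "fm \<Rightarrow> fm" (\<open>\<^bold>\<not> _\<close> [65] 65) where
  "\<^bold>\<not> \<phi> \<equiv> \<phi> \<^bold>\<rightarrow> \<^bold>\<bottom>"

abbreviation Iff :: "fm \<Rightarrow> fm \<Rightarrow> fm" (infix \<open>\<^bold>\<leftrightarrow>\<close> 51) where
  "\<phi> \<^bold>\<leftrightarrow> \<psi> \<equiv> (\<phi> \<^bold>\<rightarrow> \<psi>) \<^bold>\<and> (\<psi> \<^bold>\<rightarrow> \<phi>)"

abbreviation Succ :: "nterm \<Rightarrow> nterm" where
  "Succ t \<equiv> SuccF \<^bold>\<cdot> t"

abbreviation App2 :: "fterm \<Rightarrow> nterm \<Rightarrow> nterm \<Rightarrow> nterm" where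
  "App2 f s t \<equiv> f \<^bold>\<cdot> J s t"

text \<open>Triples associate to the left: \<open>\<beta>(m,n,p)\<close> is \<open>\<beta>(J(J(m,n),p))\<close>.\<close>

abbreviation App3 :: "fterm \<Rightarrow> nterm \<Rightarrow> nterm \<Rightarrow> nterm \<Rightarrow> nterm" where
  "App3 f s t u \<equiv> f \<^bold>\<cdot> J (J s t) u"

primrec fvar_f :: "fterm \<Rightarrow> nat set" where
  "fvar_f (FVar a) = {a}"
| "fvar_f ZeroF = {}"
| "fvar_f IdF = {}"
| "fvar_f SuccF = {}"
| "fvar_f KF = {}"
| "fvar_f LF = {}"

primrec nvar_t :: "nterm \<Rightarrow> nat set" where
  "nvar_t (NVar x) = {x}"
| "nvar_t \<^bold>0 = {}"
| "nvar_t (f \<^bold>\<cdot> t) = nvar_t t"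
| "nvar_t (J s t) = nvar_t s \<union> nvar_t t"

primrec fvar_t :: "nterm \<Rightarrow> nat set" where
  "fvar_t (NVar x) = {}"
| "fvar_t \<^bold>0 = {}"
| "fvar_t (f \<^bold>\<cdot> t) = fvar_f f \<union> fvar_t t"
| "fvar_t (J s t) = fvar_t s \<union> fvar_t t"

primrec nfree :: "fm \<Rightarrow> nat set" where
  "nfree (s \<^bold>= t) = nvar_t s \<union> nvar_t t"
| "nfree \<^bold>\<bottom> = {}"
| "nfree (\<phi> \<^bold>\<and> \<psi>) = nfree \<phi> \<union> nfree \<psi>"
| "nfree (\<phi> \<^bold>\<or> \<psi>) = nfree \<phi> \<union> nfree \<psi>"
| "nfree (\<phi> \<^bold>\<rightarrow> \<psi>) = nfree \<phi> \<union> nfree \<psi>"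
| "nfree (AllN x \<phi>) = nfree \<phi> - {x}"
| "nfree (ExN x \<phi>) = nfree \<phi> - {x}"
| "nfree (AllF a \<phi>) = nfree \<phi>"
| "nfree (ExF a \<phi>) = nfree \<phi>"

primrec ffree :: "fm \<Rightarrow> nat set" where
  "ffree (s \<^bold>= t) = fvar_t s \<union> fvar_t t"
| "ffree \<^bold>\<bottom> = {}"
| "ffree (\<phi> \<^bold>\<and> \<psi>) = ffree \<phi> \<union> ffree \<psi>"
| "ffree (\<phi> \<^bold>\<or> \<psi>) = ffree \<phi> \<union> ffree \<psi>"
| "ffree (\<phi> \<^bold>\<rightarrow> \<psi>) = ffree \<phi> \<union> ffree \<psi>"
| "ffree (AllN x \<phi>) = ffree \<phi>"
| "ffree (ExN x \<phi>) = ffree \<phi>"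
| "ffree (AllF a \<phi>) = ffree \<phi> - {a}"
| "ffree (ExF a \<phi>) = ffree \<phi> - {a}"

primrec nsub_t :: "nat \<Rightarrow> nterm \<Rightarrow> nterm \<Rightarrow> nterm" where
  "nsub_t x u (NVar y) = (if y = x then u else NVar y)"
| "nsub_t x u \<^bold>0 = \<^bold>0"
| "nsub_t x u (f \<^bold>\<cdot> t) = f \<^bold>\<cdot> nsub_t x u t"
| "nsub_t x u (J s t) = J (nsub_t x u s) (nsub_t x u t)"

text \<open>Plain replacement of free occurrences, without renaming of bound variables. All uses below
  are guarded by \<open>nfree_for\<close>, \<open>ffree_for\<close>, or are cases where no capture can occur.\<close>

primrec nsub :: "nat \<Rightarrow> nterm \<Rightarrow> fm \<Rightarrow> fm" where
  "nsub x u (s \<^bold>= t) = (nsub_t x u s \<^bold>= nsub_t x u t)"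
| "nsub x u \<^bold>\<bottom> = \<^bold>\<bottom>"
| "nsub x u (\<phi> \<^bold>\<and> \<psi>) = nsub x u \<phi> \<^bold>\<and> nsub x u \<psi>"
| "nsub x u (\<phi> \<^bold>\<or> \<psi>) = nsub x u \<phi> \<^bold>\<or> nsub x u \<psi>"
| "nsub x u (\<phi> \<^bold>\<rightarrow> \<psi>) = nsub x u \<phi> \<^bold>\<rightarrow> nsub x u \<psi>"
| "nsub x u (AllN y \<phi>) = AllN y (if y = x then \<phi> else nsub x u \<phi>)"
| "nsub x u (ExN y \<phi>) = ExN y (if y = x then \<phi> else nsub x u \<phi>)"
| "nsub x u (AllF a \<phi>) = AllF a (nsub x u \<phi>)"
| "nsub x u (ExF a \<phi>) = ExF a (nsub x u \<phi>)"

primrec nfree_for :: "nterm \<Rightarrow> nat \<Rightarrow> fm \<Rightarrow> bool" where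
  "nfree_for u x (s \<^bold>= t) \<longleftrightarrow> True"
| "nfree_for u x \<^bold>\<bottom> \<longleftrightarrow> True"
| "nfree_for u x (\<phi> \<^bold>\<and> \<psi>) \<longleftrightarrow> nfree_for u x \<phi> \<and> nfree_for u x \<psi>"
| "nfree_for u x (\<phi> \<^bold>\<or> \<psi>) \<longleftrightarrow> nfree_for u x \<phi> \<and> nfree_for u x \<psi>"
| "nfree_for u x (\<phi> \<^bold>\<rightarrow> \<psi>) \<longleftrightarrow> nfree_for u x \<phi> \<and> nfree_for u x \<psi>"
| "nfree_for u x (AllN y \<phi>) \<longleftrightarrow> x \<notin> nfree (AllN y \<phi>) \<or> y \<notin> nvar_t u \<and> nfree_for u x \<phi>"
| "nfree_for u x (ExN y \<phi>) \<longleftrightarrow> x \<notin> nfree (ExN y \<phi>) \<or> y \<notin> nvar_t u \<and> nfree_for u x \<phi>"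
| "nfree_for u x (AllF a \<phi>) \<longleftrightarrow> x \<notin> nfree (AllF a \<phi>) \<or> a \<notin> fvar_t u \<and> nfree_for u x \<phi>"
| "nfree_for u x (ExF a \<phi>) \<longleftrightarrow> x \<notin> nfree (ExF a \<phi>) \<or> a \<notin> fvar_t u \<and> nfree_for u x \<phi>"

primrec fsub_f :: "nat \<Rightarrow> fterm \<Rightarrow> fterm \<Rightarrow> fterm" where
  "fsub_f a g (FVar b) = (if b = a then g else FVar b)"
| "fsub_f a g ZeroF = ZeroF"
| "fsub_f a g IdF = IdF"
| "fsub_f a g SuccF = SuccF"
| "fsub_f a g KF = KF"
| "fsub_f a g LF = LF"

primrec fsub_t :: "nat \<Rightarrow> fterm \<Rightarrow> nterm \<Rightarrow> nterm" where
  "fsub_t a g (NVar y) = NVar y"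
| "fsub_t a g \<^bold>0 = \<^bold>0"
| "fsub_t a g (f \<^bold>\<cdot> t) = fsub_f a g f \<^bold>\<cdot> fsub_t a g t"
| "fsub_t a g (J s t) = J (fsub_t a g s) (fsub_t a g t)"

primrec fsub :: "nat \<Rightarrow> fterm \<Rightarrow> fm \<Rightarrow> fm" where
  "fsub a g (s \<^bold>= t) = (fsub_t a g s \<^bold>= fsub_t a g t)"
| "fsub a g \<^bold>\<bottom> = \<^bold>\<bottom>"
| "fsub a g (\<phi> \<^bold>\<and> \<psi>) = fsub a g \<phi> \<^bold>\<and> fsub a g \<psi>"
| "fsub a g (\<phi> \<^bold>\<or> \<psi>) = fsub a g \<phi> \<^bold>\<or> fsub a g \<psi>"
| "fsub a g (\<phi> \<^bold>\<rightarrow> \<psi>) = fsub a g \<phi> \<^bold>\<rightarrow> fsub a g \<psi>"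
| "fsub a g (AllN y \<phi>) = AllN y (fsub a g \<phi>)"
| "fsub a g (ExN y \<phi>) = ExN y (fsub a g \<phi>)"
| "fsub a g (AllF b \<phi>) = AllF b (if b = a then \<phi> else fsub a g \<phi>)"
| "fsub a g (ExF b \<phi>) = ExF b (if b = a then \<phi> else fsub a g \<phi>)"

primrec ffree_for :: "fterm \<Rightarrow> nat \<Rightarrow> fm \<Rightarrow> bool" where
  "ffree_for g a (s \<^bold>= t) \<longleftrightarrow> True"
| "ffree_for g a \<^bold>\<bottom> \<longleftrightarrow> True"
| "ffree_for g a (\<phi> \<^bold>\<and> \<psi>) \<longleftrightarrow> ffree_for g a \<phi> \<and> ffree_for g a \<psi>"
| "ffree_for g a (\<phi> \<^bold>\<or> \<psi>) \<longleftrightarrow> ffree_for g a \<phi> \<and> ffree_for g a \<psi>"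
| "ffree_for g a (\<phi> \<^bold>\<rightarrow> \<psi>) \<longleftrightarrow> ffree_for g a \<phi> \<and> ffree_for g a \<psi>"
| "ffree_for g a (AllN y \<phi>) \<longleftrightarrow> ffree_for g a \<phi>"
| "ffree_for g a (ExN y \<phi>) \<longleftrightarrow> ffree_for g a \<phi>"
| "ffree_for g a (AllF b \<phi>) \<longleftrightarrow> a \<notin> ffree (AllF b \<phi>) \<or> b \<notin> fvar_f g \<and> ffree_for g a \<phi>"
| "ffree_for g a (ExF b \<phi>) \<longleftrightarrow> a \<notin> ffree (ExF b \<phi>) \<or> b \<notin> fvar_f g \<and> ffree_for g a \<phi>"

text \<open>
  \<open>T\<close> is a set of axioms and \<open>\<Gamma>\<close> the set of open assumptions. The variable conditions of the
  quantifier rules concern \<open>\<Gamma>\<close> only: an axiom with free variables counts as its universal closure.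
\<close>

inductive derives :: "fm set \<Rightarrow> fm set \<Rightarrow> fm \<Rightarrow> bool" (\<open>_; _ \<turnstile> _\<close> [51, 51, 49] 48) for T where
  axiom: "\<phi> \<in> T \<Longrightarrow> T; \<Gamma> \<turnstile> \<phi>"
| assm: "\<phi> \<in> \<Gamma> \<Longrightarrow> T; \<Gamma> \<turnstile> \<phi>"
| falsumE: "T; \<Gamma> \<turnstile> \<^bold>\<bottom> \<Longrightarrow> T; \<Gamma> \<turnstile> \<phi>"
| andI: "T; \<Gamma> \<turnstile> \<phi> \<Longrightarrow> T; \<Gamma> \<turnstile> \<psi> \<Longrightarrow> T; \<Gamma> \<turnstile> \<phi> \<^bold>\<and> \<psi>"
| andE1: "T; \<Gamma> \<turnstile> \<phi> \<^bold>\<and> \<psi> \<Longrightarrow> T; \<Gamma> \<turnstile> \<phi>"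
| andE2: "T; \<Gamma> \<turnstile> \<phi> \<^bold>\<and> \<psi> \<Longrightarrow> T; \<Gamma> \<turnstile> \<psi>"
| orI1: "T; \<Gamma> \<turnstile> \<phi> \<Longrightarrow> T; \<Gamma> \<turnstile> \<phi> \<^bold>\<or> \<psi>"
| orI2: "T; \<Gamma> \<turnstile> \<psi> \<Longrightarrow> T; \<Gamma> \<turnstile> \<phi> \<^bold>\<or> \<psi>"
| orE: "T; \<Gamma> \<turnstile> \<phi> \<^bold>\<or> \<psi> \<Longrightarrow> T; insert \<phi> \<Gamma> \<turnstile> \<chi> \<Longrightarrow> T; insert \<psi> \<Gamma> \<turnstile> \<chi> \<Longrightarrow> T; \<Gamma> \<turnstile> \<chi>"
| impI: "T; insert \<phi> \<Gamma> \<turnstile> \<psi> \<Longrightarrow> T; \<Gamma> \<turnstile> \<phi> \<^bold>\<rightarrow> \<psi>"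
| impE: "T; \<Gamma> \<turnstile> \<phi> \<^bold>\<rightarrow> \<psi> \<Longrightarrow> T; \<Gamma> \<turnstile> \<phi> \<Longrightarrow> T; \<Gamma> \<turnstile> \<psi>"
| allNI: "T; \<Gamma> \<turnstile> \<phi> \<Longrightarrow> \<forall>\<chi>\<in>\<Gamma>. x \<notin> nfree \<chi> \<Longrightarrow> T; \<Gamma> \<turnstile> AllN x \<phi>"
| allNE: "T; \<Gamma> \<turnstile> AllN x \<phi> \<Longrightarrow> nfree_for t x \<phi> \<Longrightarrow> T; \<Gamma> \<turnstile> nsub x t \<phi>"
| exNI: "T; \<Gamma> \<turnstile> nsub x t \<phi> \<Longrightarrow> nfree_for t x \<phi> \<Longrightarrow> T; \<Gamma> \<turnstile> ExN x \<phi>"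
| exNE: "T; \<Gamma> \<turnstile> ExN x \<phi> \<Longrightarrow> T; insert \<phi> \<Gamma> \<turnstile> \<psi> \<Longrightarrow> \<forall>\<chi>\<in>insert \<psi> \<Gamma>. x \<notin> nfree \<chi> \<Longrightarrow> T; \<Gamma> \<turnstile> \<psi>"
| allFI: "T; \<Gamma> \<turnstile> \<phi> \<Longrightarrow> \<forall>\<chi>\<in>\<Gamma>. a \<notin> ffree \<chi> \<Longrightarrow> T; \<Gamma> \<turnstile> AllF a \<phi>"
| allFE: "T; \<Gamma> \<turnstile> AllF a \<phi> \<Longrightarrow> ffree_for g a \<phi> \<Longrightarrow> T; \<Gamma> \<turnstile> fsub a g \<phi>"
| exFI: "T; \<Gamma> \<turnstile> fsub a g \<phi> \<Longrightarrow> ffree_for g a \<phi> \<Longrightarrow> T; \<Gamma> \<turnstile> ExF a \<phi>"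
| exFE: "T; \<Gamma> \<turnstile> ExF a \<phi> \<Longrightarrow> T; insert \<phi> \<Gamma> \<turnstile> \<psi> \<Longrightarrow> \<forall>\<chi>\<in>insert \<psi> \<Gamma>. a \<notin> ffree \<chi> \<Longrightarrow> T; \<Gamma> \<turnstile> \<psi>"

text \<open>
  The order relations are not primitive. We read \<open>s \<le> t\<close> as \<open>\<exists>q. s + q = t\<close>, and \<open>s < t\<close> as
  \<open>S(s) \<le> t\<close>. There is no function symbol for addition either, so it is introduced by its recursion
  equations: some \<open>\<delta>\<close> has \<open>\<delta>(m,0) = m\<close> and \<open>\<delta>(m,S(n)) = S(\<delta>(m,n))\<close> for all \<open>m, n\<close>, and
  \<open>\<delta>(s,q) = t\<close>. Such a \<open>\<delta>\<close> exists by primitive recursion and is extensionally unique by induction.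
  The bound variables are chosen above all variables of \<open>s\<close> and \<open>t\<close>.
\<close>

primrec nbound :: "nterm \<Rightarrow> nat" where
  "nbound (NVar x) = Suc x"
| "nbound \<^bold>0 = 0"
| "nbound (f \<^bold>\<cdot> t) = nbound t"
| "nbound (J s t) = max (nbound s) (nbound t)"

primrec fbound_f :: "fterm \<Rightarrow> nat" where
  "fbound_f (FVar a) = Suc a"
| "fbound_f ZeroF = 0"
| "fbound_f IdF = 0"
| "fbound_f SuccF = 0"
| "fbound_f KF = 0"
| "fbound_f LF = 0"

primrec fbound :: "nterm \<Rightarrow> nat" where
  "fbound (NVar x) = 0"
| "fbound \<^bold>0 = 0"
| "fbound (f \<^bold>\<cdot> t) = max (fbound_f f) (fbound t)"
| "fbound (J s t) = max (fbound s) (fbound t)"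

definition is_addition :: "fterm \<Rightarrow> fm" where
  "is_addition f = AllN 0 (AllN 1
     (App2 f (NVar 0) \<^bold>0 \<^bold>= NVar 0 \<^bold>\<and>
      App2 f (NVar 0) (Succ (NVar 1)) \<^bold>= Succ (App2 f (NVar 0) (NVar 1))))"

definition Leq :: "nterm \<Rightarrow> nterm \<Rightarrow> fm" (infix \<open>\<^bold>\<le>\<close> 70) where
  "s \<^bold>\<le> t = (let q = max (nbound s) (nbound t); d = max (fbound s) (fbound t) in
     ExF d (is_addition (FVar d) \<^bold>\<and> ExN q (App2 (FVar d) s (NVar q) \<^bold>= t)))"

definition Less :: "nterm \<Rightarrow> nterm \<Rightarrow> fm" (infix \<open>\<^bold><\<close> 70) where
  "s \<^bold>< t = (Succ s \<^bold>\<le> t)"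

abbreviation (input) var_m :: nterm (\<open>\<^bold>m\<close>) where "\<^bold>m \<equiv> NVar 0"
abbreviation (input) var_n :: nterm (\<open>\<^bold>n\<close>) where "\<^bold>n \<equiv> NVar 1"
abbreviation (input) var_alpha :: fterm (\<open>\<^bold>\<alpha>\<close>) where "\<^bold>\<alpha> \<equiv> FVar 0"
abbreviation (input) var_beta :: fterm (\<open>\<^bold>\<beta>\<close>) where "\<^bold>\<beta> \<equiv> FVar 1"
abbreviation (input) var_gamma :: fterm (\<open>\<^bold>\<gamma>\<close>) where "\<^bold>\<gamma> \<equiv> FVar 2"

definition refl_ax :: fm where
  "refl_ax = AllN 0 (\<^bold>m \<^bold>= \<^bold>m)"

text \<open>
  Equality on numbers is the only primitive equality, so reflexivity and replacement of equal number
  terms suffice to derive symmetry, transitivity and congruence for function terms and \<open>J\<close>.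
\<close>

definition replacement_ax :: "nat \<Rightarrow> nterm \<Rightarrow> nterm \<Rightarrow> fm \<Rightarrow> fm" where
  "replacement_ax x s t \<phi> = (s \<^bold>= t \<^bold>\<rightarrow> nsub x s \<phi> \<^bold>\<rightarrow> nsub x t \<phi>)"

text \<open>Neither \<open>\<^bold>0\<close> nor \<open>S(x)\<close> can be captured when substituted for \<open>x\<close>, so no side condition is needed.\<close>

definition induction_ax :: "nat \<Rightarrow> fm \<Rightarrow> fm" where
  "induction_ax x \<phi> = (nsub x \<^bold>0 \<phi> \<^bold>\<and> AllN x (\<phi> \<^bold>\<rightarrow> nsub x (Succ (NVar x)) \<phi>) \<^bold>\<rightarrow> AllN x \<phi>)"

definition constants_ax :: fm where
  "constants_ax = AllN 0 (AllN 1
     (ZeroF \<^bold>\<cdot> \<^bold>n \<^bold>= \<^bold>0 \<^bold>\<and> IdF \<^bold>\<cdot> \<^bold>n \<^bold>= \<^bold>n \<^bold>\<and>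
      \<^bold>\<not> (Succ \<^bold>n \<^bold>= \<^bold>0) \<^bold>\<and> (Succ \<^bold>m \<^bold>= Succ \<^bold>n \<^bold>\<rightarrow> \<^bold>m \<^bold>= \<^bold>n) \<^bold>\<and>
      KF \<^bold>\<cdot> J \<^bold>m \<^bold>n \<^bold>= \<^bold>m \<^bold>\<and> LF \<^bold>\<cdot> J \<^bold>m \<^bold>n \<^bold>= \<^bold>n \<^bold>\<and> J (KF \<^bold>\<cdot> \<^bold>n) (LF \<^bold>\<cdot> \<^bold>n) \<^bold>= \<^bold>n))"

definition composition_ax :: fm where
  "composition_ax = AllF 0 (AllF 1 (ExF 2 (AllN 1 (\<^bold>\<gamma> \<^bold>\<cdot> \<^bold>n \<^bold>= \<^bold>\<alpha> \<^bold>\<cdot> \<^bold>\<beta> \<^bold>\<cdot> \<^bold>n))))"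

definition pairing_ax :: fm where
  "pairing_ax = AllF 0 (AllF 1 (ExF 2 (AllN 1 (\<^bold>\<gamma> \<^bold>\<cdot> \<^bold>n \<^bold>= J (\<^bold>\<alpha> \<^bold>\<cdot> \<^bold>n) (\<^bold>\<beta> \<^bold>\<cdot> \<^bold>n)))))"

definition primrec_ax :: fm where
  "primrec_ax = AllF 0 (AllF 1 (ExF 2 (AllN 0 (AllN 1
     (App2 \<^bold>\<gamma> \<^bold>m \<^bold>0 \<^bold>= \<^bold>\<alpha> \<^bold>\<cdot> \<^bold>m \<^bold>\<and>
      App2 \<^bold>\<gamma> \<^bold>m (Succ \<^bold>n) \<^bold>= App3 \<^bold>\<beta> \<^bold>m \<^bold>n (App2 \<^bold>\<gamma> \<^bold>m \<^bold>n))))))"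

definition search_ax :: fm where
  "search_ax = AllF 0
     (AllN 0 (ExN 1 (App2 \<^bold>\<alpha> \<^bold>m \<^bold>n \<^bold>= \<^bold>0)) \<^bold>\<rightarrow>
      ExF 2 (AllN 0 (App2 \<^bold>\<alpha> \<^bold>m (\<^bold>\<gamma> \<^bold>\<cdot> \<^bold>m) \<^bold>= \<^bold>0 \<^bold>\<and>
        AllN 1 (\<^bold>n \<^bold>< \<^bold>\<gamma> \<^bold>\<cdot> \<^bold>m \<^bold>\<rightarrow> \<^bold>\<not> (App2 \<^bold>\<alpha> \<^bold>m \<^bold>n \<^bold>= \<^bold>0)))))"

definition BIM :: "fm set" where
  "BIM = {refl_ax} \<union> {replacement_ax x s t \<phi> | x s t \<phi>. nfree_for s x \<phi> \<and> nfree_for t x \<phi>} \<union>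
     {induction_ax x \<phi> | x \<phi>. True} \<union>
     {constants_ax, composition_ax, pairing_ax, primrec_ax, search_ax}"

text \<open>\<open>CF_d\<close> is a schema. The formula \<open>B\<close> may contain parameters of both sorts.\<close>

definition CF_d :: "fm set" where
  "CF_d = {AllN x (B \<^bold>\<or> \<^bold>\<not> B) \<^bold>\<rightarrow>
       ExF b (AllN x (FVar b \<^bold>\<cdot> NVar x \<^bold>\<le> Succ \<^bold>0 \<^bold>\<and> (FVar b \<^bold>\<cdot> NVar x \<^bold>= \<^bold>0 \<^bold>\<leftrightarrow> B)))
     | x b B. b \<notin> ffree B}"

end

theory Submission
  imports Defs "HOL-Library.Countable"
begin

text \<open>
  We interpret \<open>BIM\<close> classically: numbers are the natural numbers, functions range over a class \<open>F\<close>
  that contains the constants and is closed under the function existence axioms. Since \<open>B \<or> \<not> B\<close>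
  is true, \<open>CF_d\<close> puts the characteristic function of every definable set into \<open>F\<close>. Take for \<open>F\<close> the
  functions computable by programs with an oracle \<open>\<alpha>\<close>. The oracle is made self-referential, so that
  no universal machine has to be built inside \<open>F\<close>: \<open>\<alpha>(x,s) = 0\<close> iff program number \<open>x\<close> halts
  on input \<open>x\<close> with a positive output while asking the oracle only about arguments below
  \<open>(x,s)\<close>. As a halting computation asks only finitely many questions, the set of all \<open>x\<close> with
  \<open>\<exists>s. \<alpha>(x,s) = 0\<close> diagonalizes against every program with oracle \<open>\<alpha>\<close>, although it is
  definable from \<open>\<alpha> \<in> F\<close>.
\<close>

section \<open>Classical semantics\<close>

text \<open>\<open>K\<close> and \<open>L\<close> are read as the inverse of the Cantor pairing,
  which is onto, as surjectivity of pairing in \<open>constants_ax\<close> demands.\<close>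

primrec val_f :: "(nat \<Rightarrow> nat \<Rightarrow> nat) \<Rightarrow> fterm \<Rightarrow> nat \<Rightarrow> nat" where
  "val_f h (FVar a) = h a"
| "val_f h ZeroF = (\<lambda>n. 0)"
| "val_f h IdF = (\<lambda>n. n)"
| "val_f h SuccF = Suc"
| "val_f h KF = (\<lambda>n. fst (prod_decode n))"
| "val_f h LF = (\<lambda>n. snd (prod_decode n))"

primrec val :: "(nat \<Rightarrow> nat) \<Rightarrow> (nat \<Rightarrow> nat \<Rightarrow> nat) \<Rightarrow> nterm \<Rightarrow> nat" where
  "val e h (NVar x) = e x"
| "val e h \<^bold>0 = 0"
| "val e h (f \<^bold>\<cdot> t) = val_f h f (val e h t)"
| "val e h (J s t) = prod_encode (val e h s, val e h t)"

text \<open>Henkin semantics: the function sort is cut down to \<open>F\<close>. With all functions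
  in \<open>F\<close>, \<open>CF_d\<close> would be classically true.\<close>

primrec sat :: "(nat \<Rightarrow> nat) set \<Rightarrow> (nat \<Rightarrow> nat) \<Rightarrow> (nat \<Rightarrow> nat \<Rightarrow> nat) \<Rightarrow> fm \<Rightarrow> bool" where
  "sat F e h (s \<^bold>= t) \<longleftrightarrow> val e h s = val e h t"
| "sat F e h \<^bold>\<bottom> \<longleftrightarrow> False"
| "sat F e h (\<phi> \<^bold>\<and> \<psi>) \<longleftrightarrow> sat F e h \<phi> \<and> sat F e h \<psi>"
| "sat F e h (\<phi> \<^bold>\<or> \<psi>) \<longleftrightarrow> sat F e h \<phi> \<or> sat F e h \<psi>"
| "sat F e h (\<phi> \<^bold>\<rightarrow> \<psi>) \<longleftrightarrow> (sat F e h \<phi> \<longrightarrow> sat F e h \<psi>)"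
| "sat F e h (AllN x \<phi>) \<longleftrightarrow> (\<forall>n. sat F (e(x := n)) h \<phi>)"
| "sat F e h (ExN x \<phi>) \<longleftrightarrow> (\<exists>n. sat F (e(x := n)) h \<phi>)"
| "sat F e h (AllF a \<phi>) \<longleftrightarrow> (\<forall>f\<in>F. sat F e (h(a := f)) \<phi>)"
| "sat F e h (ExF a \<phi>) \<longleftrightarrow> (\<exists>f\<in>F. sat F e (h(a := f)) \<phi>)"

section \<open>Coincidence and substitution lemmas\<close>

lemma val_f_cong: "(\<And>a. a \<in> fvar_f f \<Longrightarrow> h a = h' a) \<Longrightarrow> val_f h f = val_f h' f"
  by (cases f) auto

lemma val_cong:
  "(\<And>x. x \<in> nvar_t t \<Longrightarrow> e x = e' x) \<Longrightarrow> (\<And>a. a \<in> fvar_t t \<Longrightarrow> h a = h' a) \<Longrightarrow>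
    val e h t = val e' h' t"
proof (induction t)
  case (App f t)
  have "val_f h f = val_f h' f"
    by (rule val_f_cong) (simp add: App.prems)
  then show ?case
    using App by simp
qed auto

lemma sat_cong:
  "(\<And>x. x \<in> nfree \<phi> \<Longrightarrow> e x = e' x) \<Longrightarrow> (\<And>a. a \<in> ffree \<phi> \<Longrightarrow> h a = h' a) \<Longrightarrow>
    sat F e h \<phi> \<longleftrightarrow> sat F e' h' \<phi>"
proof (induction \<phi> arbitrary: e e' h h')
  case (Eq s t)
  have "val e h s = val e' h' s" "val e h t = val e' h' t"
    by (rule val_cong; simp add: Eq)+
  then show ?case
    by simp
next
  case (And \<phi> \<psi>)
  have "sat F e h \<phi> \<longleftrightarrow> sat F e' h' \<phi>" "sat F e h \<psi> \<longleftrightarrow> sat F e' h' \<psi>"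
    by (rule And.IH; simp add: And.prems)+
  then show ?case
    by simp
next
  case (Or \<phi> \<psi>)
  have "sat F e h \<phi> \<longleftrightarrow> sat F e' h' \<phi>" "sat F e h \<psi> \<longleftrightarrow> sat F e' h' \<psi>"
    by (rule Or.IH; simp add: Or.prems)+
  then show ?case
    by simp
next
  case (Imp \<phi> \<psi>)
  have "sat F e h \<phi> \<longleftrightarrow> sat F e' h' \<phi>" "sat F e h \<psi> \<longleftrightarrow> sat F e' h' \<psi>"
    by (rule Imp.IH; simp add: Imp.prems)+
  then show ?case
    by simp
next
  case (AllN x \<phi>)
  have "sat F (e(x := n)) h \<phi> \<longleftrightarrow> sat F (e'(x := n)) h' \<phi>" for n
    by (rule AllN.IH; simp add: AllN.prems)
  then show ?case
    by simp
next
  case (ExN x \<phi>)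
  have "sat F (e(x := n)) h \<phi> \<longleftrightarrow> sat F (e'(x := n)) h' \<phi>" for n
    by (rule ExN.IH; simp add: ExN.prems)
  then show ?case
    by simp
next
  case (AllF a \<phi>)
  have "sat F e (h(a := f)) \<phi> \<longleftrightarrow> sat F e' (h'(a := f)) \<phi>" for f
    by (rule AllF.IH; simp add: AllF.prems)
  then show ?case
    by simp
next
  case (ExF a \<phi>)
  have "sat F e (h(a := f)) \<phi> \<longleftrightarrow> sat F e' (h'(a := f)) \<phi>" for f
    by (rule ExF.IH; simp add: ExF.prems)
  then show ?case
    by simp
qed simp

lemma sat_fresh_n: "x \<notin> nfree \<phi> \<Longrightarrow> sat F (e(x := n)) h \<phi> \<longleftrightarrow> sat F e h \<phi>"
  by (rule sat_cong) auto

lemma sat_fresh_f: "a \<notin> ffree \<phi> \<Longrightarrow> sat F e (h(a := f)) \<phi> \<longleftrightarrow> sat F e h \<phi>"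
  by (rule sat_cong) auto

lemma val_fresh_n: "x \<notin> nvar_t t \<Longrightarrow> val (e(x := n)) h t = val e h t"
  by (rule val_cong) auto

lemma val_fresh_f: "a \<notin> fvar_t t \<Longrightarrow> val e (h(a := f)) t = val e h t"
  by (rule val_cong) auto

lemma val_f_fresh: "a \<notin> fvar_f g \<Longrightarrow> val_f (h(a := f)) g = val_f h g"
  by (rule val_f_cong) auto

lemma val_nsub_t: "val e h (nsub_t x u t) = val (e(x := val e h u)) h t"
  by (induction t) auto

lemma val_f_fsub_f: "val_f h (fsub_f a g f) = val_f (h(a := val_f h g)) f"
  by (cases f) auto

lemma val_fsub_t: "val e h (fsub_t a g t) = val e (h(a := val_f h g)) t"
  by (induction t) (simp_all only: val.simps fsub_t.simps val_f_fsub_f)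

lemma nsub_t_fresh: "x \<notin> nvar_t t \<Longrightarrow> nsub_t x u t = t"
  by (induction t) auto

lemma nsub_fresh: "x \<notin> nfree \<phi> \<Longrightarrow> nsub x u \<phi> = \<phi>"
  by (induction \<phi>) (auto simp: nsub_t_fresh)

lemma fsub_f_fresh: "a \<notin> fvar_f f \<Longrightarrow> fsub_f a g f = f"
  by (cases f) auto

lemma fsub_t_fresh: "a \<notin> fvar_t t \<Longrightarrow> fsub_t a g t = t"
  by (induction t) (auto simp: fsub_f_fresh)

lemma fsub_fresh: "a \<notin> ffree \<phi> \<Longrightarrow> fsub a g \<phi> = \<phi>"
  by (induction \<phi>) (auto simp: fsub_t_fresh)

text \<open>At a quantifier \<open>nfree_for\<close> leaves two cases: the substitution is vacuous,
  or the bound variable avoids \<open>u\<close>. In the latter the value of \<open>u\<close> is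
  unaffected by the quantifier and the updates commute.\<close>

lemma sat_nsub:
  "nfree_for u x \<phi> \<Longrightarrow> sat F e h (nsub x u \<phi>) \<longleftrightarrow> sat F (e(x := val e h u)) h \<phi>"
proof (induction \<phi> arbitrary: e h)
  case (AllN y \<phi>)
  show ?case
  proof (cases "x \<in> nfree (AllN y \<phi>)")
    case True
    then have fresh: "y \<noteq> x" "y \<notin> nvar_t u" "nfree_for u x \<phi>"
      using AllN.prems by auto
    then have "sat F (e(y := n)) h (nsub x u \<phi>) \<longleftrightarrow> sat F (e(x := val e h u, y := n)) h \<phi>" for n
      by (simp only: AllN.IH val_fresh_n fun_upd_twist[of y x] not_False_eq_True)
    with fresh show ?thesis
      by (simp add: fun_upd_def)
  next
    case False
    then show ?thesis
      by (simp only: nsub_fresh sat_fresh_n not_False_eq_True)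
  qed
next
  case (ExN y \<phi>)
  show ?case
  proof (cases "x \<in> nfree (ExN y \<phi>)")
    case True
    then have fresh: "y \<noteq> x" "y \<notin> nvar_t u" "nfree_for u x \<phi>"
      using ExN.prems by auto
    then have "sat F (e(y := n)) h (nsub x u \<phi>) \<longleftrightarrow> sat F (e(x := val e h u, y := n)) h \<phi>" for n
      by (simp only: ExN.IH val_fresh_n fun_upd_twist[of y x] not_False_eq_True)
    with fresh show ?thesis
      by (simp add: fun_upd_def)
  next
    case False
    then show ?thesis
      by (simp only: nsub_fresh sat_fresh_n not_False_eq_True)
  qed
next
  case (AllF a \<phi>)
  show ?case
  proof (cases "x \<in> nfree (AllF a \<phi>)")
    case True
    with AllF show ?thesis
      by (auto simp: val_fresh_f simp del: fun_upd_apply)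
  next
    case False
    then show ?thesis
      by (simp only: nsub_fresh sat_fresh_n not_False_eq_True)
  qed
next
  case (ExF a \<phi>)
  show ?case
  proof (cases "x \<in> nfree (ExF a \<phi>)")
    case True
    with ExF show ?thesis
      by (auto simp: val_fresh_f simp del: fun_upd_apply)
  next
    case False
    then show ?thesis
      by (simp only: nsub_fresh sat_fresh_n not_False_eq_True)
  qed
qed (auto simp: val_nsub_t)

lemma sat_fsub:
  "ffree_for g a \<phi> \<Longrightarrow> sat F e h (fsub a g \<phi>) \<longleftrightarrow> sat F e (h(a := val_f h g)) \<phi>"
proof (induction \<phi> arbitrary: e h)
  case (AllF b \<phi>)
  show ?case
  proof (cases "a \<in> ffree (AllF b \<phi>)")
    case True
    then have fresh: "b \<noteq> a" "b \<notin> fvar_f g" "ffree_for g a \<phi>"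
      using AllF.prems by auto
    then have "sat F e (h(b := f)) (fsub a g \<phi>) \<longleftrightarrow> sat F e (h(a := val_f h g, b := f)) \<phi>" for f
      by (simp only: AllF.IH val_f_fresh fun_upd_twist[of b a] not_False_eq_True)
    with fresh show ?thesis
      by (simp add: fun_upd_def)
  next
    case False
    then show ?thesis
      by (simp only: fsub_fresh sat_fresh_f not_False_eq_True)
  qed
next
  case (ExF b \<phi>)
  show ?case
  proof (cases "a \<in> ffree (ExF b \<phi>)")
    case True
    then have fresh: "b \<noteq> a" "b \<notin> fvar_f g" "ffree_for g a \<phi>"
      using ExF.prems by auto
    then have "sat F e (h(b := f)) (fsub a g \<phi>) \<longleftrightarrow> sat F e (h(a := val_f h g, b := f)) \<phi>" for f
      by (simp only: ExF.IH val_f_fresh fun_upd_twist[of b a] not_False_eq_True)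
    with fresh show ?thesis
      by (simp add: fun_upd_def)
  next
    case False
    then show ?thesis
      by (simp only: fsub_fresh sat_fresh_f not_False_eq_True)
  qed
qed (auto simp: val_fsub_t)

lemma nfree_for_Zero: "nfree_for \<^bold>0 x \<phi>"
  by (induction \<phi>) auto

lemma nfree_for_Succ: "nfree_for (Succ (NVar x)) x \<phi>"
  by (induction \<phi>) auto

section \<open>Soundness\<close>

text \<open>One closure condition per function existence axiom. Since values of variables are in
  \<open>F\<close> anyway, \<open>val_f_mem\<close> amounts to \<open>F\<close> containing the
  constants; this form suits the rules that instantiate function terms.\<close>

locale function_class =
  fixes F :: "(nat \<Rightarrow> nat) set"
  assumes val_f_mem: "\<And>h g. range h \<subseteq> F \<Longrightarrow> val_f h g \<in> F"
    and comp: "\<And>f g. f \<in> F \<Longrightarrow> g \<in> F \<Longrightarrow> (\<lambda>n. f (g n)) \<in> F"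
    and pair: "\<And>f g. f \<in> F \<Longrightarrow> g \<in> F \<Longrightarrow> (\<lambda>n. prod_encode (f n, g n)) \<in> F"
    and primitive_recursion: "\<And>f g. f \<in> F \<Longrightarrow> g \<in> F \<Longrightarrow>
      \<exists>r\<in>F. \<forall>m n. r (prod_encode (m, 0)) = f m \<and>
        r (prod_encode (m, Suc n)) = g (prod_encode (prod_encode (m, n), r (prod_encode (m, n))))"
    and search: "\<And>f. f \<in> F \<Longrightarrow> \<forall>m. \<exists>n. f (prod_encode (m, n)) = 0 \<Longrightarrow>
      (\<lambda>m. LEAST n. f (prod_encode (m, n)) = 0) \<in> F"
begin

text \<open>Axioms must hold under all assignments, because the quantifier rules restrict variables
  of \<open>\<Gamma>\<close> only and so may reassign the free variables of axioms.\<close>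

lemma soundness:
  assumes "T; \<Gamma> \<turnstile> \<phi>"
    and T: "\<And>\<phi> e h. \<phi> \<in> T \<Longrightarrow> range h \<subseteq> F \<Longrightarrow> sat F e h \<phi>"
    and "range h \<subseteq> F" "\<forall>\<chi>\<in>\<Gamma>. sat F e h \<chi>"
  shows "sat F e h \<phi>"
  using assms(1,3,4)
proof (induction arbitrary: e h)
  case (axiom \<phi> \<Gamma>)
  then show ?case
    using T by blast
next
  case (orE \<Gamma> \<phi> \<psi> \<chi>)
  from orE.IH(1)[OF orE.prems] show ?case
    using orE.IH(2,3)[OF orE.prems(1)] orE.prems(2) by auto
next
  case (allNI \<Gamma> \<phi> x)
  have "sat F (e(x := n)) h \<phi>" for n
    using allNI.prems allNI.hyps by (intro allNI.IH) (auto simp: sat_fresh_n simp del: fun_upd_apply)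
  then show ?case
    by simp
next
  case (allNE \<Gamma> x \<phi> t)
  then show ?case
    by (simp add: sat_nsub)
next
  case (exNI \<Gamma> x t \<phi>)
  then show ?case
    by (auto simp: sat_nsub)
next
  case (exNE \<Gamma> x \<phi> \<psi>)
  from exNE.IH(1)[OF exNE.prems] obtain n where "sat F (e(x := n)) h \<phi>"
    by auto
  then have "sat F (e(x := n)) h \<psi>"
    using exNE.prems exNE.hyps by (intro exNE.IH(2)) (auto simp: sat_fresh_n simp del: fun_upd_apply)
  then show ?case
    using exNE.hyps by (simp add: sat_fresh_n)
next
  case (allFI \<Gamma> \<phi> a)
  have "sat F e (h(a := f)) \<phi>" if "f \<in> F" for f
  proof (rule allFI.IH)
    show "range (h(a := f)) \<subseteq> F"
      using that allFI.prems(1) by auto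
    show "\<forall>\<chi>\<in>\<Gamma>. sat F e (h(a := f)) \<chi>"
      using allFI.prems(2) allFI.hyps by (simp add: sat_fresh_f)
  qed
  then show ?case
    by simp
next
  case (allFE \<Gamma> a \<phi> g)
  then show ?case
    by (simp add: sat_fsub val_f_mem)
next
  case (exFI \<Gamma> a g \<phi>)
  then show ?case
    using val_f_mem[of h g] by (simp add: sat_fsub) blast
next
  case (exFE \<Gamma> a \<phi> \<psi>)
  from exFE.IH(1)[OF exFE.prems] obtain f where f: "f \<in> F" "sat F e (h(a := f)) \<phi>"
    by auto
  have "sat F e (h(a := f)) \<psi>"
  proof (rule exFE.IH(2))
    show "range (h(a := f)) \<subseteq> F"
      using f exFE.prems(1) by auto
    show "\<forall>\<chi>\<in>insert \<phi> \<Gamma>. sat F e (h(a := f)) \<chi>"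
      using f exFE.prems(2) exFE.hyps by (simp add: sat_fresh_f)
  qed
  then show ?case
    using exFE.hyps by (simp add: sat_fresh_f)
qed auto

section \<open>Validity of the axioms of \<open>BIM\<close>\<close>

lemma sat_replacement_ax:
  "nfree_for s x \<phi> \<Longrightarrow> nfree_for t x \<phi> \<Longrightarrow> sat F e h (replacement_ax x s t \<phi>)"
  by (simp add: replacement_ax_def sat_nsub)

text \<open>The number sort is the standard \<open>nat\<close>, so induction holds even for sets
  whose characteristic function is outside \<open>F\<close>.\<close>

lemma sat_induction_ax: "sat F e h (induction_ax x \<phi>)"
proof -
  have "sat F (e(x := n)) h \<phi>"
    if "sat F (e(x := 0)) h \<phi>" "\<And>n. sat F (e(x := n)) h \<phi> \<Longrightarrow> sat F (e(x := Suc n)) h \<phi>" for n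
    using that by (induction n) auto
  then show ?thesis
    by (simp add: induction_ax_def sat_nsub nfree_for_Zero nfree_for_Succ)
qed

lemma sat_primrec_ax: "sat F e h primrec_ax"
  using primitive_recursion by (simp add: primrec_ax_def)

text \<open>In \<open>search_ax\<close> the order formula occurs only as a premise, so it suffices
  to extract a true inequality from it.\<close>

lemma is_addition_imp:
  assumes "sat F e h (is_addition (FVar d))"
  shows "\<forall>m n. h d (prod_encode (m, n)) = m + n"
proof (intro allI)
  fix m n
  have "h d (prod_encode (m, 0)) = m"
    "h d (prod_encode (m, Suc n)) = Suc (h d (prod_encode (m, n)))" for m n
    using assms by (simp_all add: is_addition_def)
  then show "h d (prod_encode (m, n)) = m + n"
    by (induction n) simp_all
qed

lemma sat_search_ax: "sat F e h search_ax"
proof -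
  have "\<exists>g\<in>F. \<forall>m. f (prod_encode (m, g m)) = 0 \<and>
      (\<forall>n. sat F (e(0 := m, 1 := n)) (h(0 := f, 2 := g)) (NVar 1 \<^bold>< FVar 2 \<^bold>\<cdot> NVar 0) \<longrightarrow>
        f (prod_encode (m, n)) \<noteq> 0)"
    if f: "f \<in> F" "\<forall>m. \<exists>n. f (prod_encode (m, n)) = 0" for f
  proof -
    define g where "g m = (LEAST n. f (prod_encode (m, n)) = 0)" for m
    have "g \<in> F"
      using search[OF f] by (simp add: g_def[abs_def])
    moreover have "f (prod_encode (m, g m)) = 0" for m
      unfolding g_def using f(2) by (meson LeastI_ex)
    moreover have "f (prod_encode (m, n)) \<noteq> 0"
      if "sat F (e(0 := m, 1 := n)) (h(0 := f, 2 := g)) (NVar 1 \<^bold>< FVar 2 \<^bold>\<cdot> NVar 0)" for m n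
    proof -
      \<comment> \<open>The order formula yields a \<open>q\<close> with
        \<open>Suc n + q = g m\<close>.\<close>
      have "n < g m"
        using that by (auto simp: Less_def Leq_def Let_def dest!: is_addition_imp)
      then show ?thesis
        unfolding g_def by (rule not_less_Least)
    qed
    ultimately show ?thesis
      by blast
  qed
  then show ?thesis
    by (simp add: search_ax_def)
qed

lemma sat_composition_ax: "sat F e h composition_ax"
  by (auto simp: composition_ax_def intro: bexI[OF _ comp])

lemma sat_pairing_ax: "sat F e h pairing_ax"
  by (auto simp: pairing_ax_def intro: bexI[OF _ pair])

lemma sat_BIM: "\<phi> \<in> BIM \<Longrightarrow> sat F e h \<phi>"
  unfolding BIM_def
  by (auto simp: refl_ax_def sat_replacement_ax sat_induction_ax constants_ax_def
      sat_composition_ax sat_pairing_ax sat_primrec_ax sat_search_ax)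

end

section \<open>Programs with an oracle\<close>

text \<open>Apart from \<open>Query\<close>, one constructor for each constant and each closure
  condition of \<open>function_class\<close>.\<close>

datatype prog = Query | PZero | PId | PSucc | PK | PL | Comp prog prog | Pair prog prog
  | Rec prog prog | Search prog

text \<open>This supplies the program numbers \<open>to_nat\<close> and \<open>from_nat\<close>. Any
  numbering will do, as no program has to decode them.\<close>

instance prog :: countable
  by countable_datatype

text \<open>The oracle is partial: a query outside its domain leaves the computation without a
  value.\<close>

inductive ev :: "(nat \<rightharpoonup> nat) \<Rightarrow> prog \<Rightarrow> nat \<Rightarrow> nat \<Rightarrow> bool" for A where
  query: "A m = Some v \<Longrightarrow> ev A Query m v"
| zero: "ev A PZero m 0"
| ident: "ev A PId m m"
| succ: "ev A PSucc m (Suc m)"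
| proj1: "ev A PK m (fst (prod_decode m))"
| proj2: "ev A PL m (snd (prod_decode m))"
| comp: "ev A q m v \<Longrightarrow> ev A p v w \<Longrightarrow> ev A (Comp p q) m w"
| pair: "ev A p m v \<Longrightarrow> ev A q m w \<Longrightarrow> ev A (Pair p q) m (prod_encode (v, w))"
| rec_0: "ev A p m v \<Longrightarrow> ev A (Rec p q) (prod_encode (m, 0)) v"
| rec_Suc: "ev A (Rec p q) (prod_encode (m, n)) v \<Longrightarrow>
    ev A q (prod_encode (prod_encode (m, n), v)) w \<Longrightarrow> ev A (Rec p q) (prod_encode (m, Suc n)) w"
| search: "ev A p (prod_encode (m, n)) 0 \<Longrightarrow>
    \<forall>k<n. \<exists>v. ev A p (prod_encode (m, k)) v \<and> 0 < v \<Longrightarrow> ev A (Search p) m n"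

lemma ev_deterministic: "ev A p m v \<Longrightarrow> ev A p m w \<Longrightarrow> v = w"
proof (induction arbitrary: w rule: ev.induct)
  case (comp q m v p w')
  from comp.prems show ?case
    by cases (use comp.IH in blast)
next
  case (pair p m v q w')
  from pair.prems show ?case
    by cases (use pair.IH in blast)
next
  case (rec_0 p m v q)
  from rec_0.prems show ?case
    by cases (use rec_0.IH in auto)
next
  case (rec_Suc p q m n v w')
  from rec_Suc.prems show ?case
    by cases (use rec_Suc.IH in auto)
next
  case (search p m n)
  from search.prems have w: "ev A p (prod_encode (m, w)) 0"
      "\<forall>k<w. \<exists>v. ev A p (prod_encode (m, k)) v \<and> 0 < v"
    by (auto elim: ev.cases)
  \<comment> \<open>For \<open>n < w\<close> the second search would have met a positive value at
    \<open>n\<close>, where the first met 0.\<close>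
  have "\<not> n < w"
    using w(2) search.IH(1) by fastforce
  moreover have "\<not> w < n"
    using w(1) search.IH(2) by fastforce
  ultimately show ?case
    by simp
qed (auto elim: ev.cases)

text \<open>The rules use defined answers only, never the absence of one, so more answers preserve
  every computation.\<close>

lemma ev_mono:
  assumes "A \<subseteq>\<^sub>m A'" "ev A p m v"
  shows "ev A' p m v"
  using assms(2)
proof (induction rule: ev.induct)
  case (query m v)
  then show ?case
    using assms(1) by (auto simp: map_le_def dom_def intro!: ev.query)
next
  case (search p m n)
  then show ?case
    by (blast intro: ev.search)
qed (blast intro: ev.intros)+

definition below :: "(nat \<Rightarrow> nat) \<Rightarrow> nat \<Rightarrow> nat \<rightharpoonup> nat" where
  "below f k = (\<lambda>j. if j < k then Some (f j) else None)"

text \<open>Use principle: a halting computation asks finitely many questions. With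
  \<open>eventually\<close>, the bounds of subcomputations combine without explicit maxima.\<close>

lemma ev_below:
  assumes "ev (\<lambda>j. Some (f j)) p m v"
  shows "eventually (\<lambda>k. ev (below f k) p m v) sequentially"
  using assms
proof (induction rule: ev.induct)
  case (query m v)
  show ?case
    using eventually_gt_at_top[of m]
    by eventually_elim (use query in \<open>auto simp: below_def intro: ev.query\<close>)
next
  case (comp q m v p w)
  from comp.IH show ?case
    by eventually_elim (blast intro: ev.comp)
next
  case (pair p m v q w)
  from pair.IH show ?case
    by eventually_elim (blast intro: ev.pair)
next
  case (rec_0 p m v q)
  from rec_0.IH show ?case
    by eventually_elim (blast intro: ev.rec_0)
next
  case (rec_Suc p q m n v w)
  from rec_Suc.IH show ?case
    by eventually_elim (blast intro: ev.rec_Suc)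
next
  case (search p m n)
  have "eventually (\<lambda>k. \<exists>v. ev (below f k) p (prod_encode (m, i)) v \<and> 0 < v) sequentially" if i: "i < n" for i
  proof -
    obtain v where "0 < v" "eventually (\<lambda>k. ev (below f k) p (prod_encode (m, i)) v) sequentially"
      using search.IH(2) i by blast
    then show ?thesis
      by (auto elim: eventually_mono)
  qed
  \<comment> \<open>Only finitely many values precede the zero, so their bounds have a common
    one.\<close>
  then have "eventually (\<lambda>k. \<forall>i\<in>{..<n}. \<exists>v. ev (below f k) p (prod_encode (m, i)) v \<and> 0 < v) sequentially"
    by (intro eventually_ball_finite) auto
  with search.IH(1) show ?case
    by eventually_elim (auto intro: ev.search)
qed (simp_all add: ev.intros)

section \<open>Functions computable from an oracle\<close>

definition computable :: "(nat \<rightharpoonup> nat) \<Rightarrow> (nat \<Rightarrow> nat) set" where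
  "computable A = {f. \<exists>p. \<forall>m. ev A p m (f m)}"

lemma computableI: "(\<And>m. ev A p m (f m)) \<Longrightarrow> f \<in> computable A"
  by (auto simp: computable_def)

lemma function_class_computable: "function_class (computable A)"
proof
  fix h :: "nat \<Rightarrow> nat \<Rightarrow> nat" and g
  assume "range h \<subseteq> computable A"
  then show "val_f h g \<in> computable A"
    by (cases g) (auto intro: computableI ev.intros)
next
  fix f g
  assume "f \<in> computable A" "g \<in> computable A"
  then obtain p q where p: "\<And>m. ev A p m (f m)" and q: "\<And>m. ev A q m (g m)"
    by (auto simp: computable_def)
  show "(\<lambda>n. f (g n)) \<in> computable A"
    by (rule computableI, rule ev.comp[OF q p])
  show "(\<lambda>n. prod_encode (f n, g n)) \<in> computable A"
    by (rule computableI, rule ev.pair[OF p q])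
  define r where "r k = (case prod_decode k of (m, n) \<Rightarrow>
    rec_nat (f m) (\<lambda>n v. g (prod_encode (prod_encode (m, n), v))) n)" for k
  have r: "r (prod_encode (m, 0)) = f m"
    "r (prod_encode (m, Suc n)) = g (prod_encode (prod_encode (m, n), r (prod_encode (m, n))))" for m n
    by (simp_all add: r_def)
  have "ev A (Rec p q) (prod_encode (m, n)) (r (prod_encode (m, n)))" for m n
  proof (induction n)
    case 0
    show ?case
      unfolding r by (rule ev.rec_0[OF p])
  next
    case (Suc n)
    show ?case
      unfolding r(2) by (rule ev.rec_Suc[OF Suc q])
  qed
  \<comment> \<open>The rules for \<open>Rec\<close> treat arguments written as pairs; every
    \<open>k\<close> is one.\<close>
  from this[of "fst (prod_decode k)" "snd (prod_decode k)" for k] have "r \<in> computable A"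
    by (intro computableI[of A "Rec p q"]) simp
  with r show "\<exists>r\<in>computable A. \<forall>m n. r (prod_encode (m, 0)) = f m \<and>
      r (prod_encode (m, Suc n)) = g (prod_encode (prod_encode (m, n), r (prod_encode (m, n))))"
    by blast
next
  fix f
  assume "f \<in> computable A" and zero: "\<forall>m. \<exists>n. f (prod_encode (m, n)) = 0"
  then obtain p where p: "\<And>m. ev A p m (f m)"
    by (auto simp: computable_def)
  show "(\<lambda>m. LEAST n. f (prod_encode (m, n)) = 0) \<in> computable A"
  proof (rule computableI, rule ev.search)
    fix m
    let ?n = "LEAST n. f (prod_encode (m, n)) = 0"
    have "f (prod_encode (m, ?n)) = 0"
      using zero by (meson LeastI_ex)
    with p[of "prod_encode (m, ?n)"] show "ev A p (prod_encode (m, ?n)) 0"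
      by simp
    show "\<forall>k<?n. \<exists>v. ev A p (prod_encode (m, k)) v \<and> 0 < v"
      using p not_less_Least by blast
  qed
qed

section \<open>The self-referential oracle\<close>

text \<open>The guard \<open>j < k\<close> makes the recursion well-founded. The first component of
  \<open>k\<close> is both program and input; the second lets the bound on questions grow.\<close>

function self_oracle :: "nat \<Rightarrow> nat" where
  "self_oracle k = (if \<exists>v>0. ev (\<lambda>j. if j < k then Some (self_oracle j) else None)
      (from_nat (fst (prod_decode k))) (fst (prod_decode k)) v then 0 else 1)"
  by auto
termination
  by (relation less_than) auto

declare self_oracle.simps [simp del]

abbreviation "self_computable \<equiv> computable (\<lambda>j. Some (self_oracle j))"

lemma self_oracle_computable: "self_oracle \<in> self_computable"
  unfolding computable_def by (auto intro: ev.query)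

lemma self_oracle_eq_0:
  "self_oracle (prod_encode (x, s)) = 0 \<longleftrightarrow>
    (\<exists>v>0. ev (below self_oracle (prod_encode (x, s))) (from_nat x) x v)"
  by (subst self_oracle.simps) (simp add: below_def)

text \<open>Removes the bound on questions: left to right by \<open>ev_mono\<close>, right to left
  by \<open>ev_below\<close>.\<close>

lemma ex_self_oracle_eq_0:
  "(\<exists>s. self_oracle (prod_encode (x, s)) = 0) \<longleftrightarrow>
    (\<exists>v>0. ev (\<lambda>j. Some (self_oracle j)) (from_nat x) x v)"
proof
  assume "\<exists>s. self_oracle (prod_encode (x, s)) = 0"
  moreover have "below self_oracle k \<subseteq>\<^sub>m (\<lambda>j. Some (self_oracle j))" for k
    by (auto simp: below_def map_le_def split: if_splits)
  ultimately show "\<exists>v>0. ev (\<lambda>j. Some (self_oracle j)) (from_nat x) x v"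
    by (meson self_oracle_eq_0 ev_mono)
next
  assume "\<exists>v>0. ev (\<lambda>j. Some (self_oracle j)) (from_nat x) x v"
  then obtain v where "0 < v" "eventually (\<lambda>k. ev (below self_oracle k) (from_nat x) x v) sequentially"
    using ev_below by blast
  then obtain s where "\<And>k. s \<le> k \<Longrightarrow> ev (below self_oracle k) (from_nat x) x v"
    by (auto simp: eventually_sequentially)
  \<comment> \<open>\<open>prod_encode (x, s)\<close> is at least \<open>s\<close>, hence a large
    enough bound.\<close>
  with \<open>0 < v\<close> show "\<exists>s. self_oracle (prod_encode (x, s)) = 0"
    unfolding self_oracle_eq_0 using le_prod_encode_2 by blast
qed

text \<open>Diagonal argument at the number of a program for \<open>f\<close>: there the set asks
  for a positive output, a characteristic function for output 0.\<close>

lemma halting_set_not_computable: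
  assumes "f \<in> self_computable"
  shows "\<exists>x. \<not> (f x = 0 \<longleftrightarrow> (\<exists>s. self_oracle (prod_encode (x, s)) = 0))"
proof -
  from assms obtain p where p: "\<And>m. ev (\<lambda>j. Some (self_oracle j)) p m (f m)"
    by (auto simp: computable_def)
  have "(\<exists>s. self_oracle (prod_encode (to_nat p, s)) = 0) \<longleftrightarrow> 0 < f (to_nat p)"
    unfolding ex_self_oracle_eq_0 using p ev_deterministic by (metis from_nat_to_nat)
  then show ?thesis
    by (intro exI[of _ "to_nat p"]) simp
qed

theorem theorem7p3: "\<not> (\<forall>\<phi>\<in>CF_d. BIM; {} \<turnstile> \<phi>)"
proof
  interpret function_class self_computable
    by (rule function_class_computable)
  \<comment> \<open>The free function variable 0 is a parameter, to be interpreted by the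
    oracle.\<close>
  define B where "B = ExN 1 (App2 (FVar 0) (NVar 0) (NVar 1) \<^bold>= \<^bold>0)"
  let ?CF = "AllN 0 (B \<^bold>\<or> \<^bold>\<not> B) \<^bold>\<rightarrow>
    ExF 1 (AllN 0 (FVar 1 \<^bold>\<cdot> NVar 0 \<^bold>\<le> Succ \<^bold>0 \<^bold>\<and> (FVar 1 \<^bold>\<cdot> NVar 0 \<^bold>= \<^bold>0 \<^bold>\<leftrightarrow> B)))"
  assume "\<forall>\<phi>\<in>CF_d. BIM; {} \<turnstile> \<phi>"
  moreover have "?CF \<in> CF_d"
    unfolding CF_d_def by (force simp: B_def)
  ultimately have "BIM; {} \<turnstile> ?CF"
    by blast
  \<comment> \<open>Every function variable denotes the oracle, so \<open>B\<close> defines the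
    diagonal set. The premise of \<open>?CF\<close> holds classically, which leaves a characteristic
    function in the class.\<close>
  then have "sat self_computable (\<lambda>_. 0) (\<lambda>_. self_oracle) ?CF"
    using self_oracle_computable by (intro soundness[OF _ sat_BIM]) auto
  then obtain f where "f \<in> self_computable"
      "\<And>x. f x = 0 \<longleftrightarrow> (\<exists>s. self_oracle (prod_encode (x, s)) = 0)"
    by (auto simp: B_def)
  with halting_set_not_computable show False
    by blast
qed

end
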